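(* Let $A$ be a $C^*$-algebra and let $a\in A$. Then the following statements are equivalent: (i) $a$ is a Moore-Penrose hermitian element; (ii) $aA=a^*A$, $a^{-1}(0)=(a^{*})^{-1}(0)$, $A=aA\oplus a^{-1}(0)$, and, if $L=L_a|_{aA}\colon aA\to aA$ and $\tilde{L}=L_{a^*}|_{aA}\colon aA\to aA$, then $L^2=\tilde{L}^2=\tilde{I}$, where $\tilde{I}$ denotes the identity map of $aA$.
   Context: An element $a$ of a $C^*$-algebra $A$ is called regular if there is $a'\in A$ with $a = aa'a$. Every regular element $a$ of a $C^*$-algebra has a unique Moore-Penrose inverse, denoted $a^{\dagger}$: the unique $x\in A$ with $a=axa$, $x=xax$, $(ax)^*=ax$, $(xa)^*=xa$. An element $a\in A$ is called Moore-Penrose hermitian if it is regular and $a^{\dagger}=a$. For $a\in A$, $L_a\colon A\to A$ is left multiplication, $L_a(x)=ax$; its range is denoted $aA=\{ax: x\in A\}$ and its null space is denoted $a^{-1}(0)=\{x\in A: ax=0\}$. Similarly $(a^* )^{-1}(0)=\{x\in A: a^*x=0\}$. *)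

theory Defs
  imports Complex_Main "HOL-Library.FuncSet"
begin

text \<open>
  Complex \<open>C\<^sup>*\<close>-algebras, not assumed to be unital. The classes real_normed_algebra and banach
  supply an associative real algebra with a complete submultiplicative norm; the complex scalar
  multiplication is required to extend the real one.
\<close>

class complex_banach_algebra = real_normed_algebra + banach +
  fixes scaleC :: "complex \<Rightarrow> 'a \<Rightarrow> 'a"  (infixr "*\<^sub>C" 75)
  assumes scaleC_add_right: "c *\<^sub>C (x + y) = c *\<^sub>C x + c *\<^sub>C y"
    and scaleC_add_left: "(c + d) *\<^sub>C x = c *\<^sub>C x + d *\<^sub>C x"
    and scaleC_scaleC: "c *\<^sub>C (d *\<^sub>C x) = (c * d) *\<^sub>C x"
    and scaleC_of_real: "complex_of_real r *\<^sub>C x = r *\<^sub>R x"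
    and scaleC_mult_left: "(c *\<^sub>C x) * y = c *\<^sub>C (x * y)"
    and scaleC_mult_right: "x * (c *\<^sub>C y) = c *\<^sub>C (x * y)"
    and norm_scaleC: "norm (c *\<^sub>C x) = cmod c * norm x"

class cstar_algebra = complex_banach_algebra +
  fixes star :: "'a \<Rightarrow> 'a"  ("_\<^sup>\<star>" [1000] 1000)
  assumes star_star: "(x\<^sup>\<star>)\<^sup>\<star> = x"
    and star_add: "(x + y)\<^sup>\<star> = x\<^sup>\<star> + y\<^sup>\<star>"
    and star_scaleC: "(c *\<^sub>C x)\<^sup>\<star> = cnj c *\<^sub>C x\<^sup>\<star>"
    and star_mult: "(x * y)\<^sup>\<star> = y\<^sup>\<star> * x\<^sup>\<star>"
    and cstar_identity: "norm (x\<^sup>\<star> * x) = (norm x)\<^sup>2"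

definition regular_element :: "'a::cstar_algebra \<Rightarrow> bool" where
  "regular_element a \<longleftrightarrow> (\<exists>a'. a = a * a' * a)"

definition is_mp_inverse :: "'a::cstar_algebra \<Rightarrow> 'a \<Rightarrow> bool" where
  "is_mp_inverse a x \<longleftrightarrow>
     a = a * x * a \<and> x = x * a * x \<and> (a * x)\<^sup>\<star> = a * x \<and> (x * a)\<^sup>\<star> = x * a"

text \<open>Only meaningful for regular elements, where existence and uniqueness hold.\<close>

definition mp_inverse :: "'a::cstar_algebra \<Rightarrow> 'a"  ("_\<^sup>\<dagger>" [1000] 1000) where
  "a\<^sup>\<dagger> = (THE x. is_mp_inverse a x)"

definition mp_hermitian :: "'a::cstar_algebra \<Rightarrow> bool" where
  "mp_hermitian a \<longleftrightarrow> regular_element a \<and> a\<^sup>\<dagger> = a"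

definition left_mult :: "'a::cstar_algebra \<Rightarrow> 'a \<Rightarrow> 'a" where
  "left_mult a = (\<lambda>x. a * x)"

definition mult_range :: "'a::cstar_algebra \<Rightarrow> 'a set" where
  "mult_range a = range (left_mult a)"

definition null_space :: "'a::cstar_algebra \<Rightarrow> 'a set" where
  "null_space a = {x. left_mult a x = 0}"

definition is_direct_sum :: "'a::cstar_algebra set \<Rightarrow> 'a set \<Rightarrow> bool" where
  "is_direct_sum S T \<longleftrightarrow> UNIV = {s + t |s t. s \<in> S \<and> t \<in> T} \<and> S \<inter> T = {0}"

end

theory Submission
  imports Defs "HOL-Analysis.Elementary_Metric_Spaces"
begin

text \<open>
  Everything reduces to the algebraic description: \<open>a\<close> is Moore-Penrose hermitian iff
  \<open>a\<^sup>3 = a\<close> and \<open>a\<^sup>2\<close> is self-adjoint (\<open>mp_hermitian_iff\<close>). Granted this, (ii) follows by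
  rewriting with \<open>a\<^sup>2 = (a\<^sup>\<star>)\<^sup>2\<close>, and multiplication by \<open>a\<^sup>2\<close> is the projection onto \<open>aA\<close> along the null space.
  Conversely, the conditions on the squares of the two restrictions in (ii) say that \<open>a\<^sup>3x = ax\<close> and
  \<open>(a\<^sup>\<star>)\<^sup>2ax = ax\<close> for all \<open>x\<close>; the factor \<open>x\<close> can be cancelled even without a unit, because
  \<open>cc\<^sup>\<star> = 0\<close> forces \<open>c = 0\<close>. Then \<open>a\<^sup>2 = (a\<^sup>\<star>)\<^sup>2a\<^sup>2 = a\<^sup>\<star>(a\<^sup>\<star>a\<^sup>2) = (a\<^sup>\<star>)\<^sup>2\<close>, the last step
  being the adjoint of \<open>(a\<^sup>\<star>)\<^sup>2a = a\<close>.

  The algebraic description rests on the fact that a regular element of a \<open>C\<^sup>*\<close>-algebra has a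
  Moore-Penrose inverse (\<open>regular_imp_mp_inverse\<close>), for otherwise \<open>a\<^sup>\<dagger>\<close> is an
  unspecified element, about which \<open>a\<^sup>\<dagger> = a\<close> says nothing. If \<open>a = aba\<close>, then \<open>ab\<close> and \<open>ba\<close>
  are idempotents; replacing them by self-adjoint idempotents \<open>q\<close> and \<open>r\<close> with the same range,
  respectively the same null space, turns \<open>b\<close> into the Moore-Penrose inverse \<open>rbq\<close>.

  To replace an idempotent \<open>p\<close> one takes \<open>q = (1 - x\<^sup>2)\<^sup>-\<^sup>1pp\<^sup>\<star>\<close> with \<open>x = p - p\<^sup>\<star>\<close>. As
  \<open>x\<close> is skew-adjoint, \<open>1 - x\<^sup>2 = (1 - x)(1 + x)\<close> is invertible. There may be no unit in \<open>A\<close>, so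
  invertibility is understood as unique solvability of \<open>w - xw = c\<close>
  in \<open>A\<close> (\<open>skew_resolvent\<close>), which comes from Banach's fixed point theorem.
\<close>

section \<open>Adjoints\<close>

lemma star_scaleR: "(r *\<^sub>R x)\<^sup>\<star> = r *\<^sub>R (x::'a::cstar_algebra)\<^sup>\<star>"
  by (metis scaleC_of_real star_scaleC complex_cnj_complex_of_real)

lemma star_minus: "(- x)\<^sup>\<star> = - (x::'a::cstar_algebra)\<^sup>\<star>"
  using star_scaleR[of "-1" x] by simp

lemma star_diff: "(x - y)\<^sup>\<star> = x\<^sup>\<star> - (y::'a::cstar_algebra)\<^sup>\<star>"
  using star_add[of x "- y"] by (simp add: star_minus)

lemma norm_star: "norm (x\<^sup>\<star>) = norm (x::'a::cstar_algebra)"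
proof -
  have le: "norm y \<le> norm (y\<^sup>\<star>)" for y :: 'a
  proof (cases "norm y = 0")
    case False
    have "norm y * norm y \<le> norm (y\<^sup>\<star>) * norm y"
      using norm_mult_ineq[of "y\<^sup>\<star>" y] by (simp add: cstar_identity power2_eq_square)
    then show ?thesis using False by simp
  qed simp
  show ?thesis using le[of x] le[of "x\<^sup>\<star>"] by (simp add: star_star)
qed

text \<open>The substitute for evaluating at a unit: take \<open>x\<close> to be the adjoint of \<open>c - d\<close>.\<close>

lemma left_mult_cancel:
  fixes c d :: "'a::cstar_algebra"
  assumes "\<And>x. c * x = d * x"
  shows "c = d"
proof -
  have "(c - d) * (c - d)\<^sup>\<star> = 0"
    using assms by (simp add: left_diff_distrib)
  then have "norm ((c - d)\<^sup>\<star>) = 0"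
    using cstar_identity[of "(c - d)\<^sup>\<star>"] by (simp add: star_star)
  then show ?thesis by (simp add: norm_star)
qed

section \<open>Inverting one minus a skew-adjoint element\<close>

text \<open>
  The cross terms of \<open>((t + x)w)\<^sup>\<star>(t + x)w\<close> cancel, so for \<open>\<parallel>w\<parallel> = 1\<close> the norm grows only like \<open>t + O(1/t)\<close>, instead
  of the \<open>t + \<parallel>x\<parallel>\<close> of the triangle inequality.
\<close>

lemma norm_skew_shift:
  fixes x w :: "'a::cstar_algebra"
  assumes "x\<^sup>\<star> = - x"
  shows "(norm (t *\<^sub>R w + x * w))\<^sup>2 \<le> (t\<^sup>2 + (norm x)\<^sup>2) * (norm w)\<^sup>2"
proof -
  have "(t *\<^sub>R w + x * w)\<^sup>\<star> * (t *\<^sub>R w + x * w) = (t * t) *\<^sub>R (w\<^sup>\<star> * w) + (x * w)\<^sup>\<star> * (x * w)"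
    using assms by (simp add: star_add star_scaleR star_mult algebra_simps mult.assoc)
  then have "(norm (t *\<^sub>R w + x * w))\<^sup>2 = norm ((t * t) *\<^sub>R (w\<^sup>\<star> * w) + (x * w)\<^sup>\<star> * (x * w))"
    by (metis cstar_identity)
  also have "\<dots> \<le> norm ((t * t) *\<^sub>R (w\<^sup>\<star> * w)) + norm ((x * w)\<^sup>\<star> * (x * w))"
    by (rule norm_triangle_ineq)
  also have "\<dots> = t\<^sup>2 * (norm w)\<^sup>2 + (norm (x * w))\<^sup>2"
    by (simp add: cstar_identity power2_eq_square)
  also have "\<dots> \<le> t\<^sup>2 * (norm w)\<^sup>2 + (norm x * norm w)\<^sup>2"
    by (intro add_left_mono power_mono norm_mult_ineq norm_ge_zero)
  finally show ?thesis by (simp add: algebra_simps power_mult_distrib)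
qed

text \<open>
  Adding \<open>tw\<close> to both sides turns the equation into the fixed point equation
  \<open>w = ((t + x)w + c)/(1 + t)\<close>, whose right-hand side is a contraction once
  \<open>t\<^sup>2 + \<parallel>x\<parallel>\<^sup>2 < (1 + t)\<^sup>2\<close>; \<open>t = \<parallel>x\<parallel>\<^sup>2\<close> is large enough for that.
\<close>

lemma skew_resolvent:
  fixes x c :: "'a::cstar_algebra"
  assumes "x\<^sup>\<star> = - x"
  shows "\<exists>!w. w - x * w = c"
proof -
  define t where "t = (norm x)\<^sup>2"
  define k where "k = sqrt (t\<^sup>2 + (norm x)\<^sup>2) / (1 + t)"
  define \<Phi> where "\<Phi> w = (1 / (1 + t)) *\<^sub>R (t *\<^sub>R w + x * w + c)" for w
  have t: "0 \<le> t" by (simp add: t_def)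
  have "t\<^sup>2 + (norm x)\<^sup>2 < (1 + t)\<^sup>2"
    unfolding t_def[symmetric] using t by (simp add: power2_sum)
  then have "sqrt (t\<^sup>2 + (norm x)\<^sup>2) < 1 + t"
    using t by (intro real_less_lsqrt) auto
  then have k: "0 \<le> k" "k < 1" using t by (simp_all add: k_def)
  have "dist (\<Phi> v) (\<Phi> w) \<le> k * dist v w" for v w
  proof -
    have "\<Phi> v - \<Phi> w = (1 / (1 + t)) *\<^sub>R (t *\<^sub>R (v - w) + x * (v - w))"
      by (simp add: \<Phi>_def algebra_simps)
    then have "norm (\<Phi> v - \<Phi> w) = norm (t *\<^sub>R (v - w) + x * (v - w)) / (1 + t)"
      using t by simp
    also have "\<dots> \<le> sqrt (t\<^sup>2 + (norm x)\<^sup>2) * norm (v - w) / (1 + t)"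
    proof (rule divide_right_mono)
      show "norm (t *\<^sub>R (v - w) + x * (v - w)) \<le> sqrt (t\<^sup>2 + (norm x)\<^sup>2) * norm (v - w)"
        using real_le_rsqrt[OF norm_skew_shift[OF assms, of t "v - w"]]
        by (simp add: real_sqrt_mult)
    qed (use t in simp)
    finally show ?thesis by (simp add: k_def dist_norm)
  qed
  then have "\<exists>!w. \<Phi> w = w"
    using banach_fix_type[OF k, of \<Phi>] by blast
  moreover have "\<Phi> w = w \<longleftrightarrow> w - x * w = c" for w
  proof -
    have "\<Phi> w = w \<longleftrightarrow> (1 + t) *\<^sub>R \<Phi> w = (1 + t) *\<^sub>R w"
      using t by simp
    also have "\<dots> \<longleftrightarrow> t *\<^sub>R w + x * w + c = (1 + t) *\<^sub>R w"
      using t by (simp add: \<Phi>_def)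
    also have "\<dots> \<longleftrightarrow> w - x * w = c"
      by (auto simp: algebra_simps)
    finally show ?thesis .
  qed
  ultimately show ?thesis by simp
qed

lemma skew_square_resolvent:
  fixes x c :: "'a::cstar_algebra"
  assumes x: "x\<^sup>\<star> = - x"
  shows "\<exists>!w. w - x * x * w = c"
proof -
  have x': "(- x)\<^sup>\<star> = - (- x)" using x by (simp add: star_minus)
  have factor: "w - x * x * w = (w + x * w) - x * (w + x * w)" for w
    by (simp add: algebra_simps)
  obtain u where u: "\<And>w. w - x * w = c \<longleftrightarrow> w = u"
    using skew_resolvent[OF x, of c] by metis
  have "\<exists>!w. w + x * w = u"
    using skew_resolvent[OF x', of u] by simp
  then show ?thesis unfolding factor u .
qed

section \<open>Self-adjoint idempotents and Moore-Penrose inverses\<close>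

text \<open>
  The element \<open>T = 1 - (p - p\<^sup>\<star>)\<^sup>2\<close> commutes with \<open>p\<close> and \<open>p\<^sup>\<star>\<close>, and \<open>pT = pp\<^sup>\<star>p\<close>. All properties
  of \<open>q = T\<^sup>-\<^sup>1pp\<^sup>\<star>\<close> are obtained by multiplying through by \<open>T\<close> and cancelling it.
\<close>

lemma idempotent_range_projection:
  fixes p :: "'a::cstar_algebra"
  assumes p: "p * p = p"
  obtains q where "q\<^sup>\<star> = q" "q * q = q" "q * p = p" "p * q = q"
proof -
  define x where "x = p - p\<^sup>\<star>"
  define T where "T w = w - x * x * w" for w
  have x: "x\<^sup>\<star> = - x" by (simp add: x_def star_diff star_star)
  have ps: "p\<^sup>\<star> * p\<^sup>\<star> = p\<^sup>\<star>" using p by (metis star_mult)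
  have T_inj: "v = w" if "T v = T w" for v w
    using skew_square_resolvent[OF x, of "T w"] that unfolding T_def by blast
  obtain q where q: "T q = p * p\<^sup>\<star>"
    using skew_square_resolvent[OF x, of "p * p\<^sup>\<star>"] unfolding T_def by blast
  have T_mult: "T (v * w) = T v * w" for v w
    by (simp add: T_def algebra_simps)
  have xx: "x * x = p - p * p\<^sup>\<star> - p\<^sup>\<star> * p + p\<^sup>\<star>"
    using p ps by (simp add: x_def algebra_simps)
  have pp: "p * (p * w) = p * w" "p\<^sup>\<star> * (p\<^sup>\<star> * w) = p\<^sup>\<star> * w" for w
    using p ps by (metis mult.assoc)+
  have Tp: "T p = p * p\<^sup>\<star> * p"
    unfolding T_def xx using p ps pp by (simp add: algebra_simps)
  have p_T: "p * T w = T (p * w)" and ps_T: "p\<^sup>\<star> * T w = T (p\<^sup>\<star> * w)" for w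
    unfolding T_def xx using pp by (simp_all add: algebra_simps)
  have qp: "q * p = p"
    by (rule T_inj) (simp add: T_mult q Tp)
  have pq: "p * q = q"
    by (rule T_inj) (simp add: p_T[symmetric] q pp)
  have qq: "q * q = q" using qp pq by (metis mult.assoc)
  have star_T: "(T w)\<^sup>\<star> = w\<^sup>\<star> - w\<^sup>\<star> * (x * x)" for w
    by (simp add: T_def star_diff star_mult x mult.assoc)
  \<comment> \<open>Since \<open>T\<close> commutes with \<open>pp\<^sup>\<star>\<close>, \<open>q\<close> also solves the equation with \<open>T\<close> on the right, and the adjoint of that equation
    is the defining equation of \<open>q\<close> for \<open>q\<^sup>\<star>\<close>.\<close>
  have "p * p\<^sup>\<star> - p * p\<^sup>\<star> * (x * x) = (T (p * p\<^sup>\<star>))\<^sup>\<star>"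
    by (simp add: star_T star_mult star_star)
  also have "\<dots> = (p * T (p\<^sup>\<star>))\<^sup>\<star>" by (simp add: p_T)
  also have "T (p\<^sup>\<star>) = p\<^sup>\<star> * p * p\<^sup>\<star>"
    unfolding T_def xx using p ps pp by (simp add: algebra_simps)
  also have "(p * (p\<^sup>\<star> * p * p\<^sup>\<star>))\<^sup>\<star> = p * p\<^sup>\<star> * (p * p\<^sup>\<star>)"
    by (simp add: star_mult star_star mult.assoc)
  also have "\<dots> = T (p * p\<^sup>\<star>)" by (simp add: T_mult Tp mult.assoc)
  also have "p * p\<^sup>\<star> - p * p\<^sup>\<star> * (x * x) = T (q - q * (x * x))"
    unfolding q[symmetric] by (simp add: T_def algebra_simps)
  finally have "T (q - q * (x * x)) = T (p * p\<^sup>\<star>)" .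
  then have "q - q * (x * x) = p * p\<^sup>\<star>" by (rule T_inj)
  then have "(q - q * (x * x))\<^sup>\<star> = p * p\<^sup>\<star>" by (simp add: star_mult star_star)
  then have "T (q\<^sup>\<star>) = T q"
    unfolding q by (simp add: T_def star_diff star_mult x mult.assoc)
  then have "q\<^sup>\<star> = q" by (rule T_inj)
  then show ?thesis using that qq qp pq by blast
qed

text \<open>
  With \<open>a = aba\<close>, let \<open>q\<close> be the self-adjoint idempotent with the range of \<open>ab\<close>, and \<open>r\<close> the one with
  the null space of \<open>ba\<close>, that is, with the range of \<open>(ba)\<^sup>\<star>\<close>. Then \<open>qa = a = ar\<close>, and
  \<open>x = rbq\<close> satisfies \<open>ax = q\<close> and \<open>xa = r\<close>.
\<close>

lemma regular_imp_mp_inverse: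
  fixes a :: "'a::cstar_algebra"
  assumes "regular_element a"
  shows "\<exists>x. is_mp_inverse a x"
proof -
  obtain b where b: "a * b * a = a" using assms by (metis regular_element_def)
  have "(a * b) * (a * b) = a * b" using b by (metis mult.assoc)
  then obtain q where q: "q\<^sup>\<star> = q" "q * q = q" "q * (a * b) = a * b" "(a * b) * q = q"
    by (rule idempotent_range_projection)
  have "(b * a) * (b * a) = b * a" using b by (metis mult.assoc)
  then have "(b * a)\<^sup>\<star> * (b * a)\<^sup>\<star> = (b * a)\<^sup>\<star>" by (metis star_mult)
  then obtain r where r: "r\<^sup>\<star> = r" "r * r = r" "r * (b * a)\<^sup>\<star> = (b * a)\<^sup>\<star>" "(b * a)\<^sup>\<star> * r = r"
    by (rule idempotent_range_projection)
  have r': "(b * a) * r = b * a" "r * (b * a) = r"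
    using r by (metis star_mult star_star)+
  have qa: "q * a = a" using q(3) b by (metis mult.assoc)
  have ar: "a * r = a" using r'(1) b by (metis mult.assoc)
  define x where "x = r * b * q"
  have ax: "a * x = q" using ar q(4) by (simp add: x_def mult.assoc[symmetric])
  have xa: "x * a = r" using qa r'(2) by (simp add: x_def mult.assoc)
  have "x * a * x = x" using r(2) unfolding xa by (simp add: x_def mult.assoc[symmetric])
  then show ?thesis
    unfolding is_mp_inverse_def using ax xa qa q(1) r(1) by metis
qed

text \<open>
  A self-adjoint idempotent is determined by its range, and also by its null space. As \<open>ax\<close> has
  the range of \<open>a\<close> and \<open>xa\<close> has the null space of \<open>a\<close>, neither depends on the choice of \<open>x\<close>,
  and they determine \<open>x\<close>.
\<close>

lemma mp_inverse_unique:
  fixes a :: "'a::cstar_algebra"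
  assumes x: "is_mp_inverse a x" and y: "is_mp_inverse a y"
  shows "x = y"
proof -
  have X: "a * x * a = a" "x * a * x = x" "(a * x)\<^sup>\<star> = a * x" "(x * a)\<^sup>\<star> = x * a"
    and Y: "a * y * a = a" "y * a * y = y" "(a * y)\<^sup>\<star> = a * y" "(y * a)\<^sup>\<star> = y * a"
    using x y by (simp_all add: is_mp_inverse_def)
  have "a * x = a * y * (a * x)" using Y(1) by (metis mult.assoc)
  also have "\<dots> = (a * x * (a * y))\<^sup>\<star>" using X(3) Y(3) by (simp add: star_mult)
  also have "\<dots> = a * y" using X(1) Y(3) by (metis mult.assoc)
  finally have ax: "a * x = a * y" .
  have "x * a = x * a * (y * a)" using Y(1) by (metis mult.assoc)
  also have "\<dots> = (y * a * (x * a))\<^sup>\<star>" using X(4) Y(4) by (simp add: star_mult)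
  also have "\<dots> = y * a" using X(1) Y(4) by (metis mult.assoc)
  finally have xa: "x * a = y * a" .
  show ?thesis using X(2) Y(2) ax xa by (metis mult.assoc)
qed

lemma mp_hermitian_iff:
  fixes a :: "'a::cstar_algebra"
  shows "mp_hermitian a \<longleftrightarrow> a * a * a = a \<and> (a * a)\<^sup>\<star> = a * a"
proof
  assume "mp_hermitian a"
  then have reg: "regular_element a" and eq: "a\<^sup>\<dagger> = a" by (simp_all add: mp_hermitian_def)
  have "is_mp_inverse a (a\<^sup>\<dagger>)"
    unfolding mp_inverse_def
    using regular_imp_mp_inverse[OF reg] mp_inverse_unique by (metis theI)
  then show "a * a * a = a \<and> (a * a)\<^sup>\<star> = a * a"
    unfolding eq by (simp add: is_mp_inverse_def)
next
  assume a: "a * a * a = a \<and> (a * a)\<^sup>\<star> = a * a"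
  then have "is_mp_inverse a a" by (simp add: is_mp_inverse_def)
  then have "a\<^sup>\<dagger> = a"
    unfolding mp_inverse_def using mp_inverse_unique by blast
  moreover have "regular_element a" using a by (metis regular_element_def)
  ultimately show "mp_hermitian a" by (simp add: mp_hermitian_def)
qed

section \<open>Moore-Penrose hermitian elements via multiplication operators\<close>

text \<open>
  The elements of \<open>aA\<close> are the products \<open>ax\<close>, so the condition on the square says
  \<open>c\<^sup>2ax = ax\<close> for all \<open>x\<close>, where \<open>x\<close> can be cancelled.
\<close>

lemma left_mult_involution_iff:
  fixes a c :: "'a::cstar_algebra"
  defines "R \<equiv> mult_range a"
  shows "compose R (restrict (left_mult c) R) (restrict (left_mult c) R) = restrict id R \<and>
      restrict (left_mult c) R \<in> R \<rightarrow> R \<longleftrightarrow>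
    c * c * a = a \<and> (\<forall>x. c * (a * x) \<in> R)"
proof -
  have closed: "restrict (left_mult c) R \<in> R \<rightarrow> R \<longleftrightarrow> (\<forall>x. c * (a * x) \<in> R)"
    unfolding Pi_iff by (auto simp: R_def mult_range_def left_mult_def)
  have "compose R (restrict (left_mult c) R) (restrict (left_mult c) R) = restrict id R \<longleftrightarrow>
      c * c * a = a" if "\<forall>x. c * (a * x) \<in> R"
  proof -
    have "compose R (restrict (left_mult c) R) (restrict (left_mult c) R) = restrict id R \<longleftrightarrow>
        (\<forall>y\<in>R. c * (c * y) = y)"
      using that by (auto simp: fun_eq_iff compose_def restrict_def R_def mult_range_def left_mult_def)
    also have "\<dots> \<longleftrightarrow> (\<forall>x. (c * c * a) * x = a * x)"
      by (auto simp: R_def mult_range_def left_mult_def mult.assoc)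
    also have "\<dots> \<longleftrightarrow> c * c * a = a"
      using left_mult_cancel[of "c * c * a" a] by auto
    finally show ?thesis .
  qed
  then show ?thesis using closed by argo
qed

theorem theorem5p1:
  fixes a :: "'a::cstar_algebra"
  shows "mp_hermitian a \<longleftrightarrow>
    (mult_range a = mult_range (a\<^sup>\<star>) \<and>
     null_space a = null_space (a\<^sup>\<star>) \<and>
     is_direct_sum (mult_range a) (null_space a) \<and>
     (let R = mult_range a;
          L = restrict (left_mult a) R;
          L' = restrict (left_mult (a\<^sup>\<star>)) R;
          I = restrict id R
      in L \<in> R \<rightarrow> R \<and> L' \<in> R \<rightarrow> R \<and>
         compose R L L = I \<and> compose R L' L' = I))"
  (is "_ \<longleftrightarrow> ?ranges \<and> ?nulls \<and> ?sum \<and> ?involutions")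
proof -
  have inv: "?involutions \<longleftrightarrow>
      (a * a * a = a \<and> (\<forall>x. a * (a * x) \<in> mult_range a)) \<and>
      (a\<^sup>\<star> * a\<^sup>\<star> * a = a \<and> (\<forall>x. a\<^sup>\<star> * (a * x) \<in> mult_range a))"
    unfolding Let_def
    using left_mult_involution_iff[of a a] left_mult_involution_iff[of a "a\<^sup>\<star>"] by argo
  show ?thesis
  proof
    assume "mp_hermitian a"
    then have cube: "a * a * a = a" and "(a * a)\<^sup>\<star> = a * a"
      by (simp_all add: mp_hermitian_iff)
    then have sq: "a\<^sup>\<star> * a\<^sup>\<star> = a * a" by (simp add: star_mult)
    have star_cube: "a\<^sup>\<star> * a\<^sup>\<star> * a\<^sup>\<star> = a\<^sup>\<star>" using cube by (metis star_mult mult.assoc)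
    have aas: "a * (a * a\<^sup>\<star>) = a\<^sup>\<star>" and asa: "a\<^sup>\<star> * (a\<^sup>\<star> * a) = a"
      and aax: "a * (a * (a * x)) = a * x" and saa: "a\<^sup>\<star> * (a * (a * x)) = a\<^sup>\<star> * x"
      and ass: "a * (a\<^sup>\<star> * (a\<^sup>\<star> * x)) = a * x" for x
      using cube sq star_cube by (metis mult.assoc)+
    have star_in: "a\<^sup>\<star> * x \<in> mult_range a" for x
      unfolding mult_range_def left_mult_def using aas by (metis mult.assoc rangeI)
    have in_star: "a * x \<in> mult_range (a\<^sup>\<star>)" for x
      unfolding mult_range_def left_mult_def using asa by (metis mult.assoc rangeI)
    have ?ranges
      using star_in in_star by (auto simp: mult_range_def left_mult_def)
    moreover have ?nulls
      unfolding null_space_def left_mult_def using saa ass by (metis mult_zero_right)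
    moreover have ?sum
    proof -
      have "\<exists>s t. y = s + t \<and> s \<in> mult_range a \<and> t \<in> null_space a" for y
      proof (intro exI conjI)
        show "y = a * (a * y) + (y - a * (a * y))" by simp
        show "a * (a * y) \<in> mult_range a" by (simp add: mult_range_def left_mult_def)
        show "y - a * (a * y) \<in> null_space a"
          by (simp add: null_space_def left_mult_def algebra_simps aax)
      qed
      moreover have "a * x = 0" if "a * (a * x) = 0" for x
        using that aax by (metis mult_zero_right)
      then have "mult_range a \<inter> null_space a = {0}"
        by (auto simp: mult_range_def null_space_def left_mult_def intro: rev_image_eqI[of 0])
      ultimately show ?thesis unfolding is_direct_sum_def by blast
    qed
    moreover have ?involutions
      unfolding inv using cube asa star_in by (simp add: mult.assoc mult_range_def left_mult_def)
    ultimately show "?ranges \<and> ?nulls \<and> ?sum \<and> ?involutions" by blast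
  next
    assume "?ranges \<and> ?nulls \<and> ?sum \<and> ?involutions"
    then have cube: "a * a * a = a" and ssa: "a\<^sup>\<star> * a\<^sup>\<star> * a = a"
      using inv by blast+
    have saa: "a\<^sup>\<star> * (a * a) = a\<^sup>\<star>" using ssa by (metis star_mult star_star)
    have "a * a = a\<^sup>\<star> * (a\<^sup>\<star> * (a * a))" using ssa by (metis mult.assoc)
    also have "\<dots> = (a * a)\<^sup>\<star>" by (simp only: saa star_mult)
    finally show "mp_hermitian a" using cube by (simp add: mp_hermitian_iff)
  qed
qed

end
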